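(* Let $(X,Y,Z)\sim P_{X,Y,Z}$ on finite alphabets. If $Z$ is a function of $(X,Y)$, then $\hat{\Psi}(X;Y\|Z)=\Psi(X;Y\|Z)$.
   Context: All random variables have finite alphabets. $I$ denotes Shannon (conditional) mutual information. Define $$\Psi(X;Y\|Z)\triangleq\inf_J\max_{(U,V)}\big[ I(X;Y|J)+I(U;J|V)-I(U;Z|V)\big],$$ where the infimum is over all finite-alphabet random variables $J$ jointly distributed with $(X,Y,Z)$ (the value depends only on $P_{J|X,Y}$ and $P_{X,Y,Z}$), and the maximum is over all finite-alphabet $(U,V)$ such that $(U,V)$ and $(J,Z)$ are conditionally independent given $(X,Y)$. Define $$\hat{\Psi}(X;Y\|Z)\triangleq\min_{J}\; \big[I(X;Y|J)+I(X,Y;J|Z)\big],$$ where the minimum is over all finite-alphabet $J$ given by conditional distributions $P_{J|X,Y,Z}$. *)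

theory Defs
  imports "HOL-Probability.Probability"
begin

text \<open>
  Information is measured to an arbitrary base \<open>b\<close>.  All alphabets are countable, so the counting
  measure on the whole type serves as reference measure; points outside the support contribute 0.
\<close>

definition cond_mutual_info ::
  "real \<Rightarrow> 'w pmf \<Rightarrow> ('w \<Rightarrow> 'a) \<Rightarrow> ('w \<Rightarrow> 'b) \<Rightarrow> ('w \<Rightarrow> 'c) \<Rightarrow> real" where
  "cond_mutual_info b p A B C =
     prob_space.conditional_mutual_information (measure_pmf p) b
       (count_space UNIV) (count_space UNIV) (count_space UNIV) A B C"

definition cond_indep_pmf ::
  "'w pmf \<Rightarrow> ('w \<Rightarrow> 'a) \<Rightarrow> ('w \<Rightarrow> 'b) \<Rightarrow> ('w \<Rightarrow> 'c) \<Rightarrow> bool" where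
  "cond_indep_pmf p A B C \<longleftrightarrow>
     (\<forall>a b c. pmf (map_pmf (\<lambda>w. (A w, B w, C w)) p) (a, b, c) * pmf (map_pmf C p) c =
              pmf (map_pmf (\<lambda>w. (A w, C w)) p) (a, c) * pmf (map_pmf (\<lambda>w. (B w, C w)) p) (b, c))"

text \<open>
  Joint laws of \<open>(X, Y, Z, J)\<close> extending a given law of \<open>(X, Y, Z)\<close>.  The alphabets of the auxiliary
  variables are arbitrary finite sets, encoded as finite sets of natural numbers.
\<close>

definition J_extensions :: "('x \<times> 'y \<times> 'z) pmf \<Rightarrow> ('x \<times> 'y \<times> 'z \<times> nat) pmf set" where
  "J_extensions P =
     {Q. finite (set_pmf Q) \<and> map_pmf (\<lambda>(x, y, z, j). (x, y, z)) Q = P}"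

text \<open>
  Joint laws of \<open>(X, Y, Z, J, U, V)\<close> extending a given law of \<open>(X, Y, Z, J)\<close> such that \<open>(U, V)\<close> and
  \<open>(J, Z)\<close> are conditionally independent given \<open>(X, Y)\<close>.
\<close>

definition UV_extensions ::
  "('x \<times> 'y \<times> 'z \<times> nat) pmf \<Rightarrow> ('x \<times> 'y \<times> 'z \<times> nat \<times> nat \<times> nat) pmf set" where
  "UV_extensions Q =
     {R. finite (set_pmf R) \<and>
         map_pmf (\<lambda>(x, y, z, j, u, v). (x, y, z, j)) R = Q \<and>
         cond_indep_pmf R
           (\<lambda>(x, y, z, j, u, v). (u, v)) (\<lambda>(x, y, z, j, u, v). (j, z)) (\<lambda>(x, y, z, j, u, v). (x, y))}"

definition Psi_objective ::
  "real \<Rightarrow> ('x \<times> 'y \<times> 'z \<times> nat \<times> nat \<times> nat) pmf \<Rightarrow> real" where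
  "Psi_objective b R =
     cond_mutual_info b R
       (\<lambda>(x, y, z, j, u, v). x) (\<lambda>(x, y, z, j, u, v). y) (\<lambda>(x, y, z, j, u, v). j)
   + cond_mutual_info b R
       (\<lambda>(x, y, z, j, u, v). u) (\<lambda>(x, y, z, j, u, v). j) (\<lambda>(x, y, z, j, u, v). v)
   - cond_mutual_info b R
       (\<lambda>(x, y, z, j, u, v). u) (\<lambda>(x, y, z, j, u, v). z) (\<lambda>(x, y, z, j, u, v). v)"

definition Psi_hat_objective :: "real \<Rightarrow> ('x \<times> 'y \<times> 'z \<times> nat) pmf \<Rightarrow> real" where
  "Psi_hat_objective b Q =
     cond_mutual_info b Q (\<lambda>(x, y, z, j). x) (\<lambda>(x, y, z, j). y) (\<lambda>(x, y, z, j). j)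
   + cond_mutual_info b Q (\<lambda>(x, y, z, j). (x, y)) (\<lambda>(x, y, z, j). j) (\<lambda>(x, y, z, j). z)"

text \<open>
  \<open>LEAST\<close> and \<open>GREATEST\<close> are used for extrema that are attained.
  The real infimum is over a nonempty set of nonnegative numbers:
  a constant \<open>U\<close> makes the last two terms of the objective vanish.
\<close>

definition Psi :: "real \<Rightarrow> ('x::finite \<times> 'y::finite \<times> 'z::finite) pmf \<Rightarrow> real" where
  "Psi b P = (INF Q \<in> J_extensions P. GREATEST r. r \<in> Psi_objective b ` UV_extensions Q)"

definition Psi_hat :: "real \<Rightarrow> ('x::finite \<times> 'y::finite \<times> 'z::finite) pmf \<Rightarrow> real" where
  "Psi_hat b P = (LEAST r. r \<in> Psi_hat_objective b ` J_extensions P)"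

end

theory Submission
  imports Defs "HOL-Real_Asymp.Real_Asymp"
begin

text \<open>
  For a fixed \<open>J\<close>, the chain rule and \<open>(U, V) - (X, Y) - (J, Z)\<close> give
  \<open>I(U; J | V) - I(U; Z | V) \<le> I(U; J | V, Z) \<le> I(U, V; J | Z) \<le> I(X, Y; J | Z)\<close>, with equality for
  \<open>U = (X, Y)\<close> and \<open>V = Z\<close>, an admissible choice when \<open>Z\<close> is a function of \<open>(X, Y)\<close>.  So both
  quantities optimise the same objective over \<open>J\<close>.  That its minimum is attained follows from writing
  the objective as a constant plus a sum over \<open>j\<close> of a continuous positively homogeneous function of
  the slice \<open>P(X, Y, Z, J = j)\<close>.
\<close>

section \<open>Entropies of functions of a finitely supported law\<close>

text \<open>Shannon entropy H(A) in expected-surprisal form: linear relations between entropies can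
  then be checked pointwise on the support of \<open>p\<close>.\<close>

definition ent :: "real \<Rightarrow> 'w pmf \<Rightarrow> ('w \<Rightarrow> 'a) \<Rightarrow> real" where
  "ent b p A = measure_pmf.expectation p (\<lambda>w. - log b (pmf (map_pmf A p) (A w)))"

lemma pmf_map_pos: "w \<in> set_pmf p \<Longrightarrow> 0 < pmf (map_pmf A p) (A w)"
  by (simp add: pmf_positive)

text \<open>Entropy depends only on the partition of the support into level sets. This serves to
  permute components of tuples, recode them injectively, or drop determined ones.\<close>

lemma ent_cong:
  assumes "\<And>w w'. w \<in> set_pmf p \<Longrightarrow> w' \<in> set_pmf p \<Longrightarrow> A w = A w' \<longleftrightarrow> B w = B w'"
  shows "ent b p A = ent b p B"
proof -
  have "pmf (map_pmf A p) (A w) = pmf (map_pmf B p) (B w)" if "w \<in> set_pmf p" for w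
  proof -
    have "A -` {A w} \<inter> set_pmf p = B -` {B w} \<inter> set_pmf p"
      using assms that by fastforce
    then show ?thesis
      by (metis measure_Int_set_pmf pmf_map)
  qed
  then show ?thesis
    unfolding ent_def by (intro integral_cong_AE) (auto simp: AE_measure_pmf_iff)
qed

lemma ent_map_pmf: "ent b (map_pmf g p) A = ent b p (\<lambda>w. A (g w))"
  by (simp add: ent_def map_pmf_comp)

lemma distributed_pmf:
  "distributed (measure_pmf p) (count_space UNIV) A (\<lambda>a. ennreal (pmf (map_pmf A p) a))"
  unfolding distributed_def
  by (auto simp flip: map_pmf_rep_eq measure_pmf_eq_density)

lemma pair_count_space_UNIV:
  "count_space (UNIV :: 'a::countable set) \<Otimes>\<^sub>M count_space (UNIV :: 'b::countable set) = count_space UNIV"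
  by (simp add: pair_measure_countable)

lemma sigma_finite_count_space_UNIV:
  "sigma_finite_measure (count_space (UNIV :: 'a::countable set))"
  by (intro sigma_finite_measure_count_space_countable) auto

lemma mutual_information_pmf:
  fixes A :: "'w \<Rightarrow> 'a::countable" and B :: "'w \<Rightarrow> 'b::countable"
  assumes b: "1 < b" and fin: "finite (set_pmf p)"
  shows "prob_space.mutual_information (measure_pmf p) b (count_space UNIV) (count_space UNIV) A B =
         ent b p A + ent b p B - ent b p (\<lambda>w. (A w, B w))"
proof -
  interpret information_space "measure_pmf p" b
    by standard (use b in auto)
  let ?q = "\<lambda>C. pmf (map_pmf C p)" and ?AB = "\<lambda>w. (A w, B w)"
  have "prob_space.mutual_information (measure_pmf p) b (count_space UNIV) (count_space UNIV) A B =
     (\<integral>x. ?q ?AB x * log b (?q ?AB x / (?q A (fst x) * ?q B (snd x)))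
        \<partial>(count_space UNIV \<Otimes>\<^sub>M count_space UNIV))"
    by (rule mutual_information_distr[where Px = "?q A" and Py = "?q B" and Pxy = "?q ?AB"])
       (simp_all add: pair_count_space_UNIV sigma_finite_count_space_UNIV distributed_pmf)
  \<comment> \<open>The joint pmf is the density of the law of \<open>(A, B)\<close>, so it can be
    absorbed into the measure.\<close>
  also have "\<dots> = (\<integral>x. log b (?q ?AB x / (?q A (fst x) * ?q B (snd x))) \<partial>map_pmf ?AB p)"
    unfolding measure_pmf_eq_density by (subst integral_density) (auto simp: pair_count_space_UNIV)
  also have "\<dots> = (\<integral>w. log b (?q ?AB (?AB w) / (?q A (A w) * ?q B (B w))) \<partial>p)"
    by simp
  also have "\<dots> = (\<integral>w. - log b (?q A (A w)) - log b (?q B (B w)) + log b (?q ?AB (?AB w)) \<partial>p)"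
    using pmf_map_pos[of _ p A] pmf_map_pos[of _ p B] pmf_map_pos[of _ p ?AB] b
    by (intro integral_cong_AE) (auto simp: AE_measure_pmf_iff log_divide log_mult less_imp_neq[THEN not_sym])
  also have "\<dots> = ent b p A + ent b p B - ent b p ?AB"
    unfolding ent_def by (simp add: integrable_measure_pmf_finite[OF fin])
  finally show ?thesis .
qed

text \<open>The underlying definition is the chain-rule difference I(A; B, C) - I(A; C), in which
  H(A) cancels.\<close>

lemma cond_mutual_info_eq_ent:
  fixes A :: "'w \<Rightarrow> 'a::countable" and B :: "'w \<Rightarrow> 'b::countable" and C :: "'w \<Rightarrow> 'c::countable"
  assumes "1 < b" and "finite (set_pmf p)"
  shows "cond_mutual_info b p A B C =
         ent b p (\<lambda>w. (A w, C w)) + ent b p (\<lambda>w. (B w, C w))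
         - ent b p (\<lambda>w. (A w, B w, C w)) - ent b p C"
  unfolding cond_mutual_info_def prob_space.conditional_mutual_information_def[OF prob_space_measure_pmf]
  by (simp add: mutual_information_pmf[OF assms] pair_count_space_UNIV)

text \<open>This is I(A; B | C) \<ge> 0 in entropy form.\<close>

lemma ent_submodular:
  fixes A :: "'w \<Rightarrow> 'a::countable" and B :: "'w \<Rightarrow> 'b::countable" and C :: "'w \<Rightarrow> 'c::countable"
  assumes b: "1 < b" and fin: "finite (set_pmf p)"
  shows "ent b p (\<lambda>w. (A w, B w, C w)) + ent b p C \<le> ent b p (\<lambda>w. (A w, C w)) + ent b p (\<lambda>w. (B w, C w))"
proof -
  interpret information_space "measure_pmf p" b
    by standard (use b in auto)
  let ?N = "count_space UNIV" and ?q = "\<lambda>C. pmf (map_pmf C p)"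
  \<comment> \<open>Integrability against the joint density means integrability under the joint law,
    which has finite support.\<close>
  have fin_supp: "integrable (count_space UNIV)
      (\<lambda>x. ?q (\<lambda>w. (A w, B w, C w)) x * f x :: real)" for f :: "'a \<times> 'b \<times> 'c \<Rightarrow> real"
    using integrable_measure_pmf_finite[of "map_pmf (\<lambda>w. (A w, B w, C w)) p" f] fin
    unfolding measure_pmf_eq_density by (simp add: integrable_density)
  have "0 \<le> prob_space.conditional_mutual_information (measure_pmf p) b ?N ?N ?N A B C"
    by (rule conditional_mutual_information_generic_nonneg[where Px = "?q A" and Pz = "?q C"
          and Pyz = "?q (\<lambda>w. (B w, C w))" and Pxz = "?q (\<lambda>w. (A w, C w))"
          and Pxyz = "?q (\<lambda>w. (A w, B w, C w))"])
       (auto simp: pair_count_space_UNIV split_beta' sigma_finite_count_space_UNIV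
             intro: distributed_pmf fin_supp)
  then show ?thesis
    using cond_mutual_info_eq_ent[OF b fin, of A B C] by (simp add: cond_mutual_info_def)
qed

text \<open>Conditional independence gives I(A; B | C) = 0: take logarithms of the product identity,
  then expectations.\<close>

lemma cond_indep_pmf_ent:
  assumes b: "1 < b" and fin: "finite (set_pmf p)" and ind: "cond_indep_pmf p A B C"
  shows "ent b p (\<lambda>w. (A w, B w, C w)) + ent b p C = ent b p (\<lambda>w. (A w, C w)) + ent b p (\<lambda>w. (B w, C w))"
proof -
  let ?q = "\<lambda>C. pmf (map_pmf C p)"
  let ?ABC = "\<lambda>w. (A w, B w, C w)" and ?AC = "\<lambda>w. (A w, C w)" and ?BC = "\<lambda>w. (B w, C w)"
  have *: "log b (?q ?ABC (?ABC w)) + log b (?q C (C w)) = log b (?q ?AC (?AC w)) + log b (?q ?BC (?BC w))"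
    if "w \<in> set_pmf p" for w
  proof -
    have "?q ?ABC (?ABC w) * ?q C (C w) = ?q ?AC (?AC w) * ?q ?BC (?BC w)"
      using ind by (simp add: cond_indep_pmf_def)
    then show ?thesis
      using pmf_map_pos[OF that, of ?ABC] pmf_map_pos[OF that, of ?AC]
        pmf_map_pos[OF that, of ?BC] pmf_map_pos[OF that, of C]
      by (simp flip: log_mult_pos)
  qed
  have "(\<integral>w. - log b (?q ?ABC (?ABC w)) + - log b (?q C (C w)) \<partial>p) =
      (\<integral>w. - log b (?q ?AC (?AC w)) + - log b (?q ?BC (?BC w)) \<partial>p)"
    by (intro integral_cong_AE) (use * in \<open>fastforce simp: AE_measure_pmf_iff\<close>)+
  then show ?thesis
    unfolding ent_def by (simp add: integrable_measure_pmf_finite[OF fin])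
qed

text \<open>If \<open>g c = a\<close>, both sides are P(B = b, C = c) P(C = c); otherwise both
  vanish.\<close>

lemma cond_indep_pmf_function:
  assumes "\<And>w. w \<in> set_pmf p \<Longrightarrow> A w = g (C w)"
  shows "cond_indep_pmf p A B C"
  unfolding cond_indep_pmf_def
proof (intro allI)
  fix a b c
  have *: "measure p ({w. A w = a \<and> E w} \<inter> set_pmf p) = measure p ({w. g (C w) = a \<and> E w} \<inter> set_pmf p)" for E
    by (rule arg_cong[where f = "measure p"]) (use assms in auto)
  have **: "measure p {w. A w = a \<and> E w} = measure p {w. g (C w) = a \<and> E w}" for E
    using * by (simp add: measure_Int_set_pmf)
  have [simp]: "(g (C w) = a \<and> C w = c) = (g c = a \<and> C w = c)" "(g (C w) = a \<and> B w = b \<and> C w = c) = (g c = a \<and> B w = b \<and> C w = c)" for w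
    by auto
  show "pmf (map_pmf (\<lambda>w. (A w, B w, C w)) p) (a, b, c) * pmf (map_pmf C p) c =
          pmf (map_pmf (\<lambda>w. (A w, C w)) p) (a, c) * pmf (map_pmf (\<lambda>w. (B w, C w)) p) (b, c)"
    by (cases "g c = a") (simp_all add: pmf_map vimage_def **)
qed

section \<open>Comparison of the two objectives for a fixed J\<close>

lemma cond_mutual_info_diff_le:
  fixes U :: "'w \<Rightarrow> 'u::countable" and V :: "'w \<Rightarrow> 'v::countable" and W :: "'w \<Rightarrow> 'x::countable"
    and J :: "'w \<Rightarrow> 'j::countable" and Z :: "'w \<Rightarrow> 'z::countable"
  assumes b: "1 < b" and fin: "finite (set_pmf p)"
    and ind: "cond_indep_pmf p (\<lambda>w. (U w, V w)) (\<lambda>w. (J w, Z w)) W"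
  shows "cond_mutual_info b p U J V - cond_mutual_info b p U Z V \<le> cond_mutual_info b p W J Z"
proof -
  \<comment> \<open>Reorderings that let the instances below speak of the same entropy terms, so
    that linear arithmetic suffices.\<close>
  have perms:
    "ent b p (\<lambda>w. (V w, J w, Z w)) = ent b p (\<lambda>w. (Z w, J w, V w))"
    "ent b p (\<lambda>w. (V w, Z w)) = ent b p (\<lambda>w. (Z w, V w))"
    "ent b p (\<lambda>w. (U w, V w, Z w)) = ent b p (\<lambda>w. (U w, Z w, V w))"
    "ent b p (\<lambda>w. (J w, U w, V w, Z w)) = ent b p (\<lambda>w. (U w, Z w, J w, V w))"
    "ent b p (\<lambda>w. ((U w, V w), Z w, W w)) = ent b p (\<lambda>w. (W w, U w, V w, Z w))"
    "ent b p (\<lambda>w. ((U w, V w), (J w, Z w), W w)) = ent b p (\<lambda>w. (W w, J w, U w, V w, Z w))"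
    "ent b p (\<lambda>w. (Z w, W w)) = ent b p (\<lambda>w. (W w, Z w))"
    "ent b p (\<lambda>w. ((J w, Z w), W w)) = ent b p (\<lambda>w. (W w, J w, Z w))"
    by (rule ent_cong; auto)+
  note sub = ent_submodular[OF b fin]
  \<comment> \<open>The first three instances are I(U; Z | J, V) \<ge> 0, I(V; J | Z) \<ge> 0 and
    I(W; J | U, V, Z) \<ge> 0. The fourth, I(U, V; Z | W) \<ge> 0, combines with I(U, V; J, Z | W) =
    0 to give I(U, V; J | W, Z) \<le> 0.\<close>
  show ?thesis
    using sub[of U Z "\<lambda>w. (J w, V w)"] sub[of V J Z] sub[of W J "\<lambda>w. (U w, V w, Z w)"]
      sub[of "\<lambda>w. (U w, V w)" Z W] cond_indep_pmf_ent[OF b fin ind] perms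
    unfolding cond_mutual_info_eq_ent[OF b fin] by linarith
qed

lemma Psi_objective_le:
  fixes Q :: "('x::finite \<times> 'y::finite \<times> 'z::finite \<times> nat) pmf"
  assumes b: "1 < b" and R: "R \<in> UV_extensions Q"
  shows "Psi_objective b R \<le> Psi_hat_objective b Q"
proof -
  have fin: "finite (set_pmf R)"
    and Q: "Q = map_pmf (\<lambda>(x, y, z, j, u, v). (x, y, z, j)) R"
    and ind: "cond_indep_pmf R (\<lambda>(x, y, z, j, u, v). (u, v)) (\<lambda>(x, y, z, j, u, v). (j, z))
      (\<lambda>(x, y, z, j, u, v). (x, y))"
    using R by (auto simp: UV_extensions_def)
  have finQ: "finite (set_pmf Q)"
    using fin Q by simp
  \<comment> \<open>Entropies of functions of (X, Y, Z, J) agree under \<open>R\<close> and its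
    marginal \<open>Q\<close>, so both objectives can be compared under \<open>R\<close>.\<close>
  have "Psi_hat_objective b Q =
      cond_mutual_info b R (\<lambda>(x, y, z, j, u, v). x) (\<lambda>(x, y, z, j, u, v). y) (\<lambda>(x, y, z, j, u, v). j)
    + cond_mutual_info b R (\<lambda>(x, y, z, j, u, v). (x, y)) (\<lambda>(x, y, z, j, u, v). j)
        (\<lambda>(x, y, z, j, u, v). z)"
    unfolding Psi_hat_objective_def cond_mutual_info_eq_ent[OF b finQ] cond_mutual_info_eq_ent[OF b fin]
    by (simp add: Q ent_map_pmf split_def)
  then show ?thesis
    using cond_mutual_info_diff_le[OF b fin ind[unfolded split_def]]
    by (simp add: Psi_objective_def split_def)
qed

lemma Psi_objective_attained:
  fixes P :: "('x::finite \<times> 'y::finite \<times> 'z::finite) pmf"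
  assumes b: "1 < b" and f: "\<forall>(x, y, z) \<in> set_pmf P. z = f (x, y)" and Q: "Q \<in> J_extensions P"
  shows "\<exists>R \<in> UV_extensions Q. Psi_objective b R = Psi_hat_objective b Q"
proof
  \<comment> \<open>U encodes (X, Y) and V encodes \<open>f (x, y)\<close>. Using
    \<open>f (x, y)\<close> instead of \<open>z\<close> makes (U, V) visibly a function of (X, Y),
    hence conditionally independent of (J, Z).\<close>
  let ?g = "\<lambda>(x, y, z, j). (x, y, z, j, to_nat (x, y), to_nat (f (x, y)))"
  let ?R = "map_pmf ?g Q"
  have fin: "finite (set_pmf Q)" and P: "P = map_pmf (\<lambda>(x, y, z, j). (x, y, z)) Q"
    using Q by (auto simp: J_extensions_def)
  have finR: "finite (set_pmf ?R)"
    using fin by simp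
  have z: "z = f (x, y)" if "(x, y, z, j) \<in> set_pmf Q" for x y z j
    using f that unfolding P by fastforce
  show "?R \<in> UV_extensions Q"
    unfolding UV_extensions_def mem_Collect_eq
  proof (intro conjI)
    show "map_pmf (\<lambda>(x, y, z, j, u, v). (x, y, z, j)) ?R = Q"
      by (simp add: map_pmf_comp split_def)
    show "cond_indep_pmf ?R (\<lambda>(x, y, z, j, u, v). (u, v)) (\<lambda>(x, y, z, j, u, v). (j, z))
        (\<lambda>(x, y, z, j, u, v). (x, y))"
      by (rule cond_indep_pmf_function[where g = "\<lambda>xy. (to_nat xy, to_nat (f xy))"]) auto
  qed (fact finR)
  \<comment> \<open>V determines Z on the support.\<close>
  have "cond_mutual_info b ?R (\<lambda>(x, y, z, j, u, v). u) (\<lambda>(x, y, z, j, u, v). z) (\<lambda>(x, y, z, j, u, v). v) = 0"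
  proof -
    have "ent b Q (\<lambda>(x, y, z, j). (to_nat (x, y), z, to_nat (f (x, y)))) =
        ent b Q (\<lambda>(x, y, z, j). (to_nat (x, y), to_nat (f (x, y))))"
      "ent b Q (\<lambda>(x, y, z, j). (z, to_nat (f (x, y)))) = ent b Q (\<lambda>(x, y, z, j). to_nat (f (x, y)))"
      by (rule ent_cong; auto dest!: z)+
    then show ?thesis
      unfolding cond_mutual_info_eq_ent[OF b finR] ent_map_pmf by (simp add: split_def)
  qed
  moreover have "cond_mutual_info b ?R (\<lambda>(x, y, z, j, u, v). u) (\<lambda>(x, y, z, j, u, v). j) (\<lambda>(x, y, z, j, u, v). v)
      = cond_mutual_info b Q (\<lambda>(x, y, z, j). (x, y)) (\<lambda>(x, y, z, j). j) (\<lambda>(x, y, z, j). z)"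
    unfolding cond_mutual_info_eq_ent[OF b finR] cond_mutual_info_eq_ent[OF b fin] ent_map_pmf
    by (intro arg_cong2[where f = "(-)"] arg_cong2[where f = "(+)"] ent_cong) (auto dest!: z)
  moreover have "cond_mutual_info b ?R (\<lambda>(x, y, z, j, u, v). x) (\<lambda>(x, y, z, j, u, v). y) (\<lambda>(x, y, z, j, u, v). j)
      = cond_mutual_info b Q (\<lambda>(x, y, z, j). x) (\<lambda>(x, y, z, j). y) (\<lambda>(x, y, z, j). j)"
    unfolding cond_mutual_info_eq_ent[OF b finR] cond_mutual_info_eq_ent[OF b fin] ent_map_pmf
    by (simp add: split_def)
  ultimately show "Psi_objective b ?R = Psi_hat_objective b Q"
    by (simp add: Psi_objective_def Psi_hat_objective_def)
qed

lemma Greatest_Psi_objective: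
  fixes P :: "('x::finite \<times> 'y::finite \<times> 'z::finite) pmf"
  assumes "1 < b" and "\<forall>(x, y, z) \<in> set_pmf P. z = f (x, y)" and "Q \<in> J_extensions P"
  shows "(GREATEST r. r \<in> Psi_objective b ` UV_extensions Q) = Psi_hat_objective b Q"
  using Psi_objective_attained[OF assms] Psi_objective_le[OF assms(1)]
  by (intro Greatest_equality) force+

section \<open>Entropy as a function of an unnormalised mass vector\<close>

text \<open>The factor \<open>t\<close> makes the value at 0 equal to 0, the usual convention 0 log
  0 = 0.\<close>

definition neg_xlogx :: "real \<Rightarrow> real \<Rightarrow> real" where
  "neg_xlogx b t = - t * log b t"

lemma continuous_on_neg_xlogx: "continuous_on {0..} (neg_xlogx b)"
  unfolding continuous_on_def
proof
  fix t :: real assume "t \<in> {0..}"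
  then consider "t = 0" | "0 < t" by fastforce
  then show "(neg_xlogx b \<longlongrightarrow> neg_xlogx b t) (at t within {0..})"
  proof cases
    case 1
    have "((\<lambda>t::real. t * ln t) \<longlongrightarrow> 0) (at_right 0)"
      by real_asymp
    from tendsto_mult_left[OF this, of "- 1 / ln b"]
    have "((\<lambda>t::real. - (t * ln t) / ln b) \<longlongrightarrow> 0) (at_right 0)"
      by simp
    moreover have "at (0::real) within {0..} = at_right 0"
      by (rule at_within_nhd[of 0 UNIV]) auto
    ultimately show ?thesis
      using 1 by (simp add: neg_xlogx_def[abs_def] log_def)
  next
    case 2
    then have "isCont (\<lambda>t. (1 / ln b) * (- t * ln t)) t"
      by (intro isCont_mult continuous_const isCont_minus continuous_ident isCont_ln) simp
    then have "isCont (neg_xlogx b) t"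
      by (simp add: neg_xlogx_def[abs_def] log_def)
    then show ?thesis
      by (simp add: continuous_at_imp_continuous_at_within continuous_within[symmetric])
  qed
qed

lemma neg_xlogx_mult:
  assumes "0 \<le> c" and "0 \<le> t"
  shows "neg_xlogx b (c * t) = c * neg_xlogx b t + t * neg_xlogx b c"
  using assms by (cases "c = 0 \<or> t = 0") (auto simp: neg_xlogx_def log_mult algebra_simps)

text \<open>The entropy formula applied to the image under \<open>A\<close> of the measure with
  masses \<open>q\<close>, whose total need not be 1.\<close>

definition ent_vec :: "real \<Rightarrow> ('i::finite \<Rightarrow> 'a::finite) \<Rightarrow> real ^ 'i \<Rightarrow> real" where
  "ent_vec b A q = (\<Sum>a\<in>UNIV. neg_xlogx b (\<Sum>i\<in>A -` {a}. q $ i))"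

text \<open>Joint rather than conditional masses: the entries add up to P(J = j).\<close>

definition slice :: "('i::finite \<times> nat) pmf \<Rightarrow> nat \<Rightarrow> real ^ 'i" where
  "slice Q j = (\<chi> i. pmf Q (i, j))"

lemma continuous_on_ent_vec: "continuous_on {q. \<forall>i. 0 \<le> q $ i} (ent_vec b A)"
  unfolding ent_vec_def
  by (intro continuous_on_sum continuous_on_compose2[OF continuous_on_neg_xlogx] continuous_intros)
     (auto intro!: sum_nonneg)

text \<open>The defect from homogeneity does not depend on \<open>A\<close>, so it cancels in
  combinations of entropies whose coefficients add up to zero.\<close>

lemma ent_vec_scaleR:
  assumes c: "0 \<le> c" and q: "\<forall>i. 0 \<le> q $ i"
  shows "ent_vec b A (c *\<^sub>R q) = c * ent_vec b A q + (\<Sum>i\<in>UNIV. q $ i) * neg_xlogx b c"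
proof -
  have "ent_vec b A (c *\<^sub>R q) = (\<Sum>a\<in>UNIV. neg_xlogx b (c * (\<Sum>i\<in>A -` {a}. q $ i)))"
    unfolding ent_vec_def sum_distrib_left by simp
  also have "\<dots> = c * ent_vec b A q + (\<Sum>a\<in>UNIV. \<Sum>i\<in>A -` {a}. q $ i) * neg_xlogx b c"
    unfolding sum_distrib_right sum_distrib_left[of c] ent_vec_def sum.distrib[symmetric]
    using q by (intro sum.cong refl) (simp add: neg_xlogx_mult[OF c] sum_nonneg flip: sum_distrib_right sum_distrib_left)
  \<comment> \<open>The fibres of \<open>A\<close> partition the index set.\<close>
  also have "(\<Sum>a\<in>UNIV. \<Sum>i\<in>A -` {a}. q $ i) = (\<Sum>i\<in>UNIV. q $ i)"
    using sum.group[of UNIV UNIV A "\<lambda>i. q $ i"] by (simp add: vimage_def)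
  finally show ?thesis .
qed

section \<open>Decomposition of entropies into slices\<close>

lemma ent_eq_sum:
  assumes "finite F" and "set_pmf (map_pmf A p) \<subseteq> F"
  shows "ent b p A = (\<Sum>a\<in>F. neg_xlogx b (pmf (map_pmf A p) a))"
proof -
  have "ent b p A = measure_pmf.expectation (map_pmf A p) (\<lambda>a. - log b (pmf (map_pmf A p) a))"
    by (simp add: ent_def)
  also have "\<dots> = (\<Sum>a\<in>F. - log b (pmf (map_pmf A p) a) * pmf (map_pmf A p) a)"
    by (rule integral_measure_pmf_real) (use assms in auto)
  finally show ?thesis
    by (simp add: neg_xlogx_def mult.commute)
qed

text \<open>The mass of (a, j) involves only slice j, so an entropy joint with J separates over
  j.\<close>

lemma ent_eq_sum_slice:
  fixes Q :: "('i::finite \<times> nat) pmf" and A :: "'i \<Rightarrow> 'a::finite"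
  assumes N: "finite N" "snd ` set_pmf Q \<subseteq> N"
  shows "ent b Q (\<lambda>(i, j). (A i, j)) = (\<Sum>j\<in>N. ent_vec b A (slice Q j))"
proof -
  have "ent b Q (\<lambda>(i, j). (A i, j)) =
      (\<Sum>x\<in>UNIV \<times> N. neg_xlogx b (pmf (map_pmf (\<lambda>(i, j). (A i, j)) Q) x))"
    by (rule ent_eq_sum) (use N in auto)
  also have "\<dots> = (\<Sum>a\<in>UNIV. \<Sum>j\<in>N. neg_xlogx b (\<Sum>i\<in>A -` {a}. slice Q j $ i))"
    unfolding sum.cartesian_product
  proof (rule sum.cong[OF refl], clarify)
    fix a j
    have "pmf (map_pmf (\<lambda>(i, j). (A i, j)) Q) (a, j) = measure Q (A -` {a} \<times> {j})"
      by (auto simp: pmf_map intro!: arg_cong[where f = "measure Q"])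
    also have "\<dots> = (\<Sum>x\<in>A -` {a} \<times> {j}. pmf Q x)"
      by (rule measure_measure_pmf_finite) simp
    also have "\<dots> = (\<Sum>i\<in>A -` {a}. slice Q j $ i)"
      using sum.cartesian_product[of "\<lambda>i j. pmf Q (i, j)" "{j}" "A -` {a}"] by (simp add: slice_def)
    finally show "neg_xlogx b (pmf (map_pmf (\<lambda>(i, j). (A i, j)) Q) (a, j)) =
        neg_xlogx b (\<Sum>i\<in>A -` {a}. slice Q j $ i)"
      by simp
  qed
  finally show ?thesis
    by (simp add: ent_vec_def sum.swap[of _ UNIV])
qed

lemma pmf_map_fst_eq_sum_slice:
  fixes Q :: "('i::finite \<times> nat) pmf"
  assumes N: "finite N" "snd ` set_pmf Q \<subseteq> N"
  shows "pmf (map_pmf fst Q) i = (\<Sum>j\<in>N. slice Q j $ i)"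
proof -
  have "fst -` {i} \<inter> set_pmf Q = ({i} \<times> N) \<inter> set_pmf Q"
    using N by auto
  then have "pmf (map_pmf fst Q) i = measure Q ({i} \<times> N)"
    by (metis measure_Int_set_pmf pmf_map)
  also have "\<dots> = (\<Sum>x\<in>{i} \<times> N. pmf Q x)"
    using N by (intro measure_measure_pmf_finite) simp
  finally show ?thesis
    using sum.cartesian_product[of "\<lambda>i j. pmf Q (i, j)" N "{i}"] by (simp add: slice_def)
qed

section \<open>Couplings built from slices, and the minimum over all couplings\<close>

text \<open>The vectors are glued into one mass function; its total is 1 because they add up to
  \<open>P\<close>.\<close>

lemma exists_pmf_with_slices:
  fixes q :: "nat \<Rightarrow> real ^ 'i::finite"
  assumes N: "finite N" and nonneg: "\<And>j i. j \<in> N \<Longrightarrow> 0 \<le> q j $ i"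
    and P: "\<And>i. (\<Sum>j\<in>N. q j $ i) = pmf P i"
  obtains Q where "finite (set_pmf Q)" and "map_pmf fst Q = P" and "snd ` set_pmf Q \<subseteq> N"
    and "\<And>j. j \<in> N \<Longrightarrow> slice Q j = q j"
proof -
  define f where "f = (\<lambda>(i, j). if j \<in> N then q j $ i else 0)"
  have f_nonneg: "0 \<le> f x" for x
    using nonneg by (auto simp: f_def split: prod.split)
  have "(\<integral>\<^sup>+x. ennreal (f x) \<partial>count_space UNIV) = (\<Sum>x\<in>UNIV \<times> N. ennreal (f x))"
    by (rule nn_integral_count_space') (use N in \<open>auto simp: f_def split: if_splits\<close>)
  also have "\<dots> = ennreal (\<Sum>x\<in>UNIV \<times> N. f x)"
    by (simp add: f_nonneg)
  also have "(\<Sum>x\<in>UNIV \<times> N. f x) = (\<Sum>i\<in>UNIV. pmf P i)"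
    by (simp add: f_def P flip: sum.cartesian_product)
  also have "\<dots> = 1"
    by (rule sum_pmf_eq_1) auto
  finally have emb: "pmf (embed_pmf f) x = f x" for x
    by (intro pmf_embed_pmf f_nonneg) simp_all
  have supp: "set_pmf (embed_pmf f) \<subseteq> UNIV \<times> N"
  proof (rule subrelI)
    fix i j assume "(i, j) \<in> set_pmf (embed_pmf f)"
    then have "f (i, j) \<noteq> 0"
      by (simp add: set_pmf_iff emb)
    then show "(i, j) \<in> UNIV \<times> N"
      by (simp add: f_def split: if_splits)
  qed
  show thesis
  proof
    show "finite (set_pmf (embed_pmf f))"
      using supp by (rule finite_subset) (simp add: N)
    show sub: "snd ` set_pmf (embed_pmf f) \<subseteq> N"
      using supp by auto
    show slice: "slice (embed_pmf f) j = q j" if "j \<in> N" for j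
      unfolding slice_def emb using that by (simp add: f_def vec_eq_iff)
    show "map_pmf fst (embed_pmf f) = P"
      by (rule pmf_eqI) (simp add: pmf_map_fst_eq_sum_slice[OF N sub] slice P)
  qed
qed

text \<open>
  Writing each slice as \<open>P(J = j)\<close> times a point of the simplex turns the sums of \<open>F\<close> over the
  slices of the couplings of \<open>P\<close> into the fibre over \<open>P\<close> of the convex hull of the graph of \<open>F\<close>.
  This hull is compact, hence the minimum exists although the number of slices is unbounded.
\<close>

lemma sum_slices_attains_min:
  fixes F :: "real ^ 'i::finite \<Rightarrow> real" and P :: "'i pmf"
  assumes cont: "continuous_on {q. \<forall>i. 0 \<le> q $ i} F"
    and hom: "\<And>c q. 0 \<le> c \<Longrightarrow> \<forall>i. 0 \<le> q $ i \<Longrightarrow> F (c *\<^sub>R q) = c * F q"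
  defines "S \<equiv> \<lambda>Q. \<Sum>j\<in>snd ` set_pmf Q. F (slice Q j)"
  defines "E \<equiv> {Q. finite (set_pmf Q) \<and> map_pmf fst Q = P}"
  shows "\<exists>Q0\<in>E. \<forall>Q\<in>E. S Q0 \<le> S Q"
proof -
  define D :: "(real ^ 'i) set" where "D = {q. (\<forall>i. 0 \<le> q $ i) \<and> (\<Sum>i\<in>UNIV. q $ i) = 1}"
  define K where "K = convex hull ((\<lambda>q. (q, F q)) ` D)"
  define p :: "real ^ 'i" where "p = (\<chi> i. pmf P i)"
  define T where "T = {t. (p, t) \<in> K}"
  have D_nonneg: "0 \<le> q $ i" if "q \<in> D" for q i
    using that by (simp add: D_def)
  have "bounded D"
  proof (rule bounded_subset)
    show "bounded (cbox (0 :: real ^ 'i) 1)"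
      by (rule bounded_cbox)
    show "D \<subseteq> cbox 0 1"
      by (auto simp: D_def mem_box_cart) (metis UNIV_I finite member_le_sum)
  qed
  moreover have "closed D"
    unfolding D_def by (intro closed_Collect_conj closed_Collect_all closed_Collect_le closed_Collect_eq continuous_intros)
  ultimately have "compact D"
    by (simp add: compact_eq_bounded_closed)
  moreover have "continuous_on D F"
    using cont by (rule continuous_on_subset) (auto simp: D_def)
  ultimately have "compact K"
    unfolding K_def by (intro compact_convex_hull compact_continuous_image continuous_intros)
  then have "compact (snd ` (K \<inter> ({p} \<times> UNIV)))"
    by (intro compact_continuous_image continuous_intros compact_Int_closed closed_Times) auto
  also have "snd ` (K \<inter> ({p} \<times> UNIV)) = T"
    by (force simp: T_def)
  finally have "compact T" .

  \<comment> \<open>With m j = P(J = j) and q j the conditional law given J = j, the slices form a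
    convex combination of points on the graph of \<open>F\<close>.\<close>
  have S_in_T: "S Q \<in> T" if Q: "Q \<in> E" for Q
  proof -
    let ?N = "snd ` set_pmf Q"
    define m where "m j = (\<Sum>i\<in>UNIV. slice Q j $ i)" for j
    have N: "finite ?N" and P: "map_pmf fst Q = P"
      using Q by (auto simp: E_def)
    have slice_nonneg: "0 \<le> slice Q j $ i" for i j
      by (simp add: slice_def)
    \<comment> \<open>Only values that J really takes occur in \<open>?N\<close>, so the
      normalisation never divides by zero.\<close>
    have m_pos: "0 < m j" if "j \<in> ?N" for j
    proof -
      obtain i where "(i, j) \<in> set_pmf Q"
        using \<open>j \<in> ?N\<close> by force
      then have "0 < slice Q j $ i"
        by (simp add: slice_def pmf_positive)
      then show ?thesis
        unfolding m_def using slice_nonneg by (intro sum_pos2[of _ i]) auto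
    qed
    have "(\<Sum>j\<in>?N. m j) = (\<Sum>i\<in>UNIV. pmf P i)"
      unfolding m_def by (subst sum.swap) (simp add: P[symmetric] pmf_map_fst_eq_sum_slice[OF N])
    also have "\<dots> = 1"
      by (rule sum_pmf_eq_1) auto
    finally have m_sum: "(\<Sum>j\<in>?N. m j) = 1" .
    define q where "q j = (1 / m j) *\<^sub>R slice Q j" for j
    have q_D: "q j \<in> D" if "j \<in> ?N" for j
      using m_pos[OF that] slice_nonneg unfolding D_def q_def
      by (simp flip: sum_divide_distrib m_def)
    have slice_q: "slice Q j = m j *\<^sub>R q j" if "j \<in> ?N" for j
      using m_pos[OF that] by (simp add: q_def)
    have "(\<Sum>j\<in>?N. m j *\<^sub>R (q j, F (q j))) \<in> K"
      unfolding K_def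
      by (rule convex_sum[OF N convex_convex_hull m_sum])
         (use m_pos q_D in \<open>auto intro!: hull_inc less_imp_le\<close>)
    also have "(\<Sum>j\<in>?N. m j *\<^sub>R (q j, F (q j))) = (\<Sum>j\<in>?N. (slice Q j, F (slice Q j)))"
    proof (rule sum.cong[OF refl])
      fix j assume j: "j \<in> ?N"
      have "F (slice Q j) = m j * F (q j)"
        unfolding slice_q[OF j] using m_pos[OF j] D_nonneg[OF q_D[OF j]] by (intro hom) auto
      then show "m j *\<^sub>R (q j, F (q j)) = (slice Q j, F (slice Q j))"
        using slice_q[OF j] by simp
    qed
    also have "\<dots> = (p, S Q)"
      by (simp add: sum_prod p_def S_def vec_eq_iff P[symmetric] pmf_map_fst_eq_sum_slice[OF N])
    finally show ?thesis
      by (simp add: T_def)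
  qed

  \<comment> \<open>Conversely, the indices of a convex combination serve as the values of J, and
    the weighted points as the slices.\<close>
  have E_of_T: "\<exists>Q\<in>E. S Q = t" if "t \<in> T" for t
  proof -
    have "(p, t) \<in> convex hull ((\<lambda>q. (q, F q)) ` D)"
      using that by (simp add: T_def K_def)
    then obtain k :: nat and u x where u: "\<And>j. j \<in> {1..k} \<Longrightarrow> 0 \<le> u j"
      and x: "\<And>j. j \<in> {1..k} \<Longrightarrow> x j \<in> (\<lambda>q. (q, F q)) ` D"
      and pt: "(\<Sum>j\<in>{1..k}. u j *\<^sub>R x j) = (p, t)"
      unfolding convex_hull_indexed by blast
    let ?q = "\<lambda>j. u j *\<^sub>R fst (x j)"
    have xD: "fst (x j) \<in> D" "x j = (fst (x j), F (fst (x j)))" if "j \<in> {1..k}" for j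
      using x[OF that] by auto
    have p_eq: "p = (\<Sum>j\<in>{1..k}. ?q j)" and t_eq: "t = (\<Sum>j\<in>{1..k}. u j * snd (x j))"
      using arg_cong[OF pt, of fst] arg_cong[OF pt, of snd] by (simp_all add: fst_sum snd_sum)
    have q_nonneg: "0 \<le> ?q j $ i" if "j \<in> {1..k}" for j i
      using u[OF that] D_nonneg[OF xD(1)[OF that]] by simp
    have "(\<Sum>j\<in>{1..k}. ?q j $ i) = pmf P i" for i
      using arg_cong[OF p_eq, of "\<lambda>v. v $ i"] by (simp add: p_def)
    then obtain Q where Q: "finite (set_pmf Q)" "map_pmf fst Q = P" "snd ` set_pmf Q \<subseteq> {1..k}"
      and slice: "\<And>j. j \<in> {1..k} \<Longrightarrow> slice Q j = ?q j"
      using exists_pmf_with_slices[of "{1..k}" ?q P] q_nonneg by auto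
    \<comment> \<open>Indices of weight zero are missing from the sum \<open>S Q\<close>; they
      contribute nothing, since homogeneity with factor 0 gives F 0 = 0.\<close>
    have "F (slice Q j) = 0" if "j \<notin> snd ` set_pmf Q" for j
    proof -
      have "slice Q j = 0"
        using that by (force simp: slice_def vec_eq_iff pmf_eq_0_set_pmf)
      then show ?thesis
        using hom[of 0 0] by simp
    qed
    then have "S Q = (\<Sum>j\<in>{1..k}. F (slice Q j))"
      unfolding S_def using Q by (intro sum.mono_neutral_left) auto
    also have "\<dots> = (\<Sum>j\<in>{1..k}. u j * snd (x j))"
    proof (rule sum.cong[OF refl])
      fix j assume j: "j \<in> {1..k}"
      have "F (?q j) = u j * F (fst (x j))"
        using u[OF j] D_nonneg[OF xD(1)[OF j]] by (intro hom) auto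
      then show "F (slice Q j) = u j * snd (x j)"
        using slice[OF j] xD(2)[OF j] by (metis snd_conv)
    qed
    finally show ?thesis
      using Q t_eq by (auto simp: E_def)
  qed

  \<comment> \<open>A constant J gives one coupling.\<close>
  have "map_pmf (\<lambda>i. (i, 0)) P \<in> E"
    by (simp add: E_def map_pmf_comp)
  then have "T \<noteq> {}"
    using S_in_T by auto
  then obtain t0 where "t0 \<in> T" "\<And>t. t \<in> T \<Longrightarrow> t0 \<le> t"
    using compact_attains_inf[OF \<open>compact T\<close>] by auto
  then show ?thesis
    using E_of_T[OF \<open>t0 \<in> T\<close>] S_in_T by metis
qed

section \<open>The minimum in \<open>Psi_hat\<close>\<close>

lemma Psi_hat_objective_attains_min:
  fixes P :: "('x::finite \<times> 'y::finite \<times> 'z::finite) pmf"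
  assumes b: "1 < b"
  obtains Q0 where "Q0 \<in> J_extensions P"
    and "\<And>Q. Q \<in> J_extensions P \<Longrightarrow> Psi_hat_objective b Q0 \<le> Psi_hat_objective b Q"
proof -
  \<comment> \<open>The last term of \<open>F\<close> is \<open>H(J)\<close>; with it the signs add up to zero, which makes \<open>F\<close> homogeneous.\<close>
  define F :: "real ^ ('x \<times> 'y \<times> 'z) \<Rightarrow> real" where
    "F q = ent_vec b (\<lambda>(x, y, z). x) q + ent_vec b (\<lambda>(x, y, z). y) q
      - ent_vec b (\<lambda>(x, y, z). (x, y)) q + ent_vec b (\<lambda>(x, y, z). z) q
      - ent_vec b (\<lambda>w. w) q - ent_vec b (\<lambda>w. ()) q" for q
  \<comment> \<open>H(X, Y, Z) - H(Z) is the part of I(X, Y; J | Z) that does not involve J.\<close>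
  define c where "c = ent b P (\<lambda>w. w) - ent b P (\<lambda>(x, y, z). z)"
  \<comment> \<open>Regrouping makes (X, Y, Z) a single index, so that couplings are laws whose
    first marginal is \<open>P\<close>.\<close>
  let ?assoc = "\<lambda>(x, y, z, j). ((x, y, z), j)"
  let ?E = "{Q. finite (set_pmf Q) \<and> map_pmf fst Q = P}"
  let ?S = "\<lambda>Q. \<Sum>j\<in>snd ` set_pmf Q. F (slice Q j)"
  have obj: "Psi_hat_objective b Q = c + ?S (map_pmf ?assoc Q)" if Q: "Q \<in> J_extensions P" for Q
  proof -
    have fin: "finite (set_pmf Q)" and P: "P = map_pmf (\<lambda>(x, y, z, j). (x, y, z)) Q"
      using Q by (auto simp: J_extensions_def)
    have N: "finite (snd ` set_pmf (map_pmf ?assoc Q))"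
      using fin by simp
    have "?S (map_pmf ?assoc Q) =
        ent b Q (\<lambda>(x, y, z, j). (x, j)) + ent b Q (\<lambda>(x, y, z, j). (y, j))
        - ent b Q (\<lambda>(x, y, z, j). ((x, y), j)) + ent b Q (\<lambda>(x, y, z, j). (z, j))
        - ent b Q (\<lambda>(x, y, z, j). ((x, y, z), j)) - ent b Q (\<lambda>(x, y, z, j). ((), j))"
      unfolding F_def sum.distrib sum_subtractf ent_eq_sum_slice[OF N order_refl, symmetric] ent_map_pmf
      by (simp add: split_def)
    moreover have
      "ent b Q (\<lambda>(x, y, z, j). ((x, y), j)) = ent b Q (\<lambda>(x, y, z, j). (x, y, j))"
      "ent b Q (\<lambda>(x, y, z, j). (z, j)) = ent b Q (\<lambda>(x, y, z, j). (j, z))"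
      "ent b Q (\<lambda>(x, y, z, j). ((x, y, z), j)) = ent b Q (\<lambda>(x, y, z, j). ((x, y), j, z))"
      "ent b Q (\<lambda>(x, y, z, j). ((), j)) = ent b Q (\<lambda>(x, y, z, j). j)"
      "ent b Q (\<lambda>(x, y, z, j). (x, y, z)) = ent b Q (\<lambda>(x, y, z, j). ((x, y), z))"
      by (rule ent_cong; auto)+
    ultimately show ?thesis
      unfolding Psi_hat_objective_def cond_mutual_info_eq_ent[OF b fin] c_def P ent_map_pmf
      by (simp add: split_def)
  qed
  have "continuous_on {q. \<forall>i. 0 \<le> q $ i} F"
    unfolding F_def by (intro continuous_intros continuous_on_ent_vec)
  moreover have "F (a *\<^sub>R q) = a * F q" if "0 \<le> a" "\<forall>i. 0 \<le> q $ i" for a q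
    unfolding F_def ent_vec_scaleR[OF that] by (simp add: algebra_simps)
  ultimately obtain Q1 where Q1: "Q1 \<in> ?E" and min: "\<And>Q. Q \<in> ?E \<Longrightarrow> ?S Q1 \<le> ?S Q"
    using sum_slices_attains_min[of F P] by blast
  let ?Q0 = "map_pmf (\<lambda>((x, y, z), j). (x, y, z, j)) Q1"
  have Q0: "?Q0 \<in> J_extensions P"
    using Q1 by (auto simp: J_extensions_def map_pmf_comp split_def)
  have assoc_Q0: "map_pmf ?assoc ?Q0 = Q1"
    by (simp add: map_pmf_comp split_def)
  show thesis
  proof
    fix Q assume Q: "Q \<in> J_extensions P"
    then have "map_pmf ?assoc Q \<in> ?E"
      by (auto simp: J_extensions_def map_pmf_comp split_def)
    from min[OF this] show "Psi_hat_objective b ?Q0 \<le> Psi_hat_objective b Q"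
      unfolding obj[OF Q0] obj[OF Q] assoc_Q0 by simp
  qed (fact Q0)
qed

theorem lemma2:
  fixes P :: "('x::finite \<times> 'y::finite \<times> 'z::finite) pmf" and b :: real
  assumes "b > 1"
    and "\<exists>f. \<forall>(x, y, z) \<in> set_pmf P. z = f (x, y)"
  shows "Psi_hat b P = Psi b P"
proof -
  obtain f where f: "\<forall>(x, y, z) \<in> set_pmf P. z = f (x, y)"
    using assms(2) by blast
  obtain Q0 where Q0: "Q0 \<in> J_extensions P"
    and min: "\<And>Q. Q \<in> J_extensions P \<Longrightarrow> Psi_hat_objective b Q0 \<le> Psi_hat_objective b Q"
    using Psi_hat_objective_attains_min[OF assms(1), of P] by blast
  have "Psi_hat b P = Psi_hat_objective b Q0"
    unfolding Psi_hat_def by (rule Least_equality) (use Q0 min in auto)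
  \<comment> \<open>An attained minimum is also the real infimum used in \<open>Psi\<close>.\<close>
  also have "\<dots> = (INF Q\<in>J_extensions P. Psi_hat_objective b Q)"
    by (rule cInf_eq_minimum[symmetric]) (use Q0 min in auto)
  also have "\<dots> = Psi b P"
    unfolding Psi_def using Greatest_Psi_objective[OF assms(1) f] by simp
  finally show ?thesis .
qed

end
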